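(* Let $K$ be an arbitrary field, and let $A,B,C\in K^{3\times 3}$ be \[ A=B=\begin{pmatrix}0&1&0\\0&0&0\\0&0&0\end{pmatrix},\qquad C=\begin{pmatrix}1&0&0\\0&0&0\\0&0&1\end{pmatrix}. \] Then \[ \min_{X\in K^{3\times 3}}\operatorname{rank}(AX-XB-C)=2 \] and \[ \min_{P\in \mathrm{GL}(6,K)}\operatorname{rank}\left(P\begin{pmatrix}A&C\\0&B\end{pmatrix}-\begin{pmatrix}A&0\\0&B\end{pmatrix}P\right)=1 . \] In particular, the two minima are not equal, so over every field $K$ the assertion that \[ \min_{X\in K^{m\times n}}\operatorname{rank}(AX-XB-C)=\min_{P\in \mathrm{GL}(m+n,K)}\operatorname{rank}\left(P\begin{pmatrix}A&C\\0&B\end{pmatrix}-\begin{pmatrix}A&0\\0&B\end{pmatrix}P\right) \] for all positive integers $m,n$ and all $A\in K^{m\times m}$, $B\in K^{n\times n}$, $C\in K^{m\times n}$ is false.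
   Context: For a field $K$ and a positive integer $r$, $\mathrm{GL}(r,K)$ denotes the set of invertible matrices in $K^{r\times r}$. The block matrices $\begin{pmatrix}A&C\\0&B\end{pmatrix}$ and $\begin{pmatrix}A&0\\0&B\end{pmatrix}$ have size $(m+n)\times(m+n)$ ($6\times 6$ when $m=n=3$). *)

theory Defs
  imports "Jordan_Normal_Form.DL_Rank"
begin

text \<open>The ambient dimension of \<^const>\<open>vec_space.rank\<close> (dimension of the column space) is the
  number of rows.\<close>

definition mat_rank :: "'a::field mat \<Rightarrow> nat" where
  "mat_rank M = vec_space.rank (dim_row M) M"

definition GL :: "nat \<Rightarrow> 'a::field mat set" where
  "GL r = {P \<in> carrier_mat r r. invertible_mat P}"

text \<open>Both minima below are infima of nonempty sets of natural numbers (the zero matrix,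
  respectively the identity matrix, is admissible), so they are attained.\<close>

definition min_rank_sylvester ::
    "nat \<Rightarrow> nat \<Rightarrow> 'a::field mat \<Rightarrow> 'a mat \<Rightarrow> 'a mat \<Rightarrow> nat" where
  "min_rank_sylvester m n A B C =
     (INF X \<in> carrier_mat m n. mat_rank (A * X - X * B - C))"

definition min_rank_similarity ::
    "nat \<Rightarrow> nat \<Rightarrow> 'a::field mat \<Rightarrow> 'a mat \<Rightarrow> 'a mat \<Rightarrow> nat" where
  "min_rank_similarity m n A B C =
     (INF P \<in> GL (m + n).
        mat_rank (P * four_block_mat A C (0\<^sub>m n m) B
                  - four_block_mat A (0\<^sub>m m n) (0\<^sub>m n m) B * P))"

end

(*
  A 2x2 minor of A X - X A - C is nonzero for every X: with x the (2,1) entry of X, the minor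
  on rows and columns {2,3} equals x, and that on rows and columns {1,3} equals 1 if x = 0.

  For the second minimum, let M = [[A,C],[0,A]] and D = [[A,0],[0,A]].  Rank 0 would make M and D
  similar, but D^2 = 0 and M^2 \<noteq> 0.  The Jordan blocks of M have sizes 3, 2, 1: the chains
  are e5 \<rightarrow> e4 \<rightarrow> e1, e6 \<rightarrow> e3 and e2 - e4.  Erasing the arrow e5 \<rightarrow> e4, a rank-one change,
  leaves sizes 2, 2, 1, 1, those of D, and conjugating the result to D yields P.
*)
theory Submission
  imports Defs "Jordan_Normal_Form.DL_Rank_Submatrix"
begin

section \<open>Lower bounds on rank from minors\<close>

lemma det_2x2:
  assumes "A \<in> carrier_mat 2 2"
  shows "det A = A $$ (0, 0) * A $$ (1, 1) - A $$ (0, 1) * A $$ (1, 0)"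
proof -
  have "det (mat_delete A 0 0) = A $$ (1, 1)" "det (mat_delete A 1 0) = A $$ (0, 1)"
    using assms by (simp_all add: mat_delete_def det_single)
  then show ?thesis
    using laplace_expansion_column[OF assms, of 0]
    by (simp add: cofactor_def numeral_2_eq_2 lessThan_Suc algebra_simps)
qed

text \<open>A nonzero minor of size k forces rank at least k; here k = 1. Contraposed, rank 0 makes
  every entry vanish.\<close>

lemma mat_rank_pos:
  assumes ij: "i < dim_row A" "j < dim_col A" and nz: "A $$ (i, j) \<noteq> 0"
  shows "1 \<le> mat_rank A"
proof -
  let ?S = "submatrix A {i} {j}"
  have card: "{k. k < dim_row A \<and> k \<in> {i}} = {i}" "{k. k < dim_col A \<and> k \<in> {j}} = {j}"
    using ij by auto
  have dim: "?S \<in> carrier_mat 1 1"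
    by (rule carrier_matI) (simp_all only: dim_submatrix card card.empty finite.intros, simp_all)
  \<comment> \<open>A selected index lands in \<open>submatrix\<close> at the position that counts
    the smaller selected indices, here 0.\<close>
  have [simp]: "{a. a = i \<and> a < i} = {}" "{a. a = j \<and> a < j} = {}" by auto
  have "?S $$ (0, 0) = A $$ (i, j)"
    using submatrix_index_card[of i A j "{i}" "{j}"] ij by simp
  then have "det ?S \<noteq> 0" using det_single[OF dim] nz by simp
  from vec_space.rank_gt_minor[OF carrier_matI[OF refl refl] this] show ?thesis
    unfolding mat_rank_def card by simp
qed

lemma mat_rank_ge_2:
  assumes ij: "i < j" "j < dim_row A" and kl: "k < l" "l < dim_col A"
    and nz: "A $$ (i, k) * A $$ (j, l) \<noteq> A $$ (i, l) * A $$ (j, k)"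
  shows "2 \<le> mat_rank A"
proof -
  let ?S = "submatrix A {i, j} {k, l}"
  have card: "{x. x < dim_row A \<and> x \<in> {i, j}} = {i, j}" "{x. x < dim_col A \<and> x \<in> {k, l}} = {k, l}"
    using ij kl by auto
  have dim: "?S \<in> carrier_mat 2 2"
    using ij kl by (intro carrier_matI) (simp_all only: dim_submatrix card, simp_all)
  \<comment> \<open>The orderings i < j and k < l place these indices at positions 0 and 1.\<close>
  have [simp]: "{x. (x = i \<or> x = j) \<and> x < i} = {}" "{x. (x = i \<or> x = j) \<and> x < j} = {i}"
    "{x. (x = k \<or> x = l) \<and> x < k} = {}" "{x. (x = k \<or> x = l) \<and> x < l} = {k}"
    using ij kl by auto
  have "?S $$ (0, 0) = A $$ (i, k)" "?S $$ (0, 1) = A $$ (i, l)"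
    "?S $$ (1, 0) = A $$ (j, k)" "?S $$ (1, 1) = A $$ (j, l)"
    using submatrix_index_card[of i A k "{i, j}" "{k, l}"] submatrix_index_card[of i A l "{i, j}" "{k, l}"]
      submatrix_index_card[of j A k "{i, j}" "{k, l}"] submatrix_index_card[of j A l "{i, j}" "{k, l}"] ij kl
    by simp_all
  then have "det ?S \<noteq> 0" using det_2x2[OF dim] nz by simp
  from vec_space.rank_gt_minor[OF carrier_matI[OF refl refl] this] show ?thesis
    using kl unfolding mat_rank_def card by simp
qed

text \<open>Intertwining twice gives P M^2 = D^2 P = 0, and P cancels. This excludes rank 0 in the
  second minimum.\<close>

lemma similar_square_zero:
  fixes P :: "'a::field mat"
  assumes P: "P \<in> GL n" and M: "M \<in> carrier_mat n n" and D: "D \<in> carrier_mat n n"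
    and eq: "P * M = D * P" and sq: "D * D = 0\<^sub>m n n"
  shows "M * M = 0\<^sub>m n n"
proof -
  from P have Pc: "P \<in> carrier_mat n n" and "invertible_mat P" by (auto simp: GL_def)
  then obtain Q where PQ: "P * Q = 1\<^sub>m n" "Q * P = 1\<^sub>m (dim_row Q)"
    unfolding invertible_mat_def inverts_mat_def by auto
  \<comment> \<open>The size of \<open>Q\<close> comes from counting columns: \<open>P * Q\<close>
    has those of \<open>Q\<close>, and \<open>Q * P\<close> has those of \<open>P\<close>.\<close>
  then have Qc: "Q \<in> carrier_mat n n"
    using Pc by (metis carrier_matD(2) carrier_matI index_mult_mat(3) index_one_mat(3))
  have "P * (M * M) = P * M * M" using Pc M by simp
  also have "\<dots> = D * P * M" by (simp only: eq)
  also have "\<dots> = D * (P * M)" using Pc M D by simp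
  also have "\<dots> = D * (D * P)" by (simp only: eq)
  also have "\<dots> = 0\<^sub>m n n" using Pc D sq by (simp flip: assoc_mult_mat[OF D D Pc])
  finally have 0: "P * (M * M) = 0\<^sub>m n n" .
  have "M * M = Q * P * (M * M)" using PQ Qc M by simp
  also have "\<dots> = Q * (P * (M * M))" using Qc Pc M by (simp add: assoc_mult_mat[of _ n n _ n _ n])
  also have "\<dots> = 0\<^sub>m n n" using 0 Qc by simp
  finally show ?thesis .
qed

section \<open>The 3x3 matrices and the first minimum\<close>

definition nilp :: "'a::field mat" where
  "nilp = mat_of_rows_list 3 [[0, 1, 0], [0, 0, 0], [0, 0, 0]]"

definition diag101 :: "'a::field mat" where
  "diag101 = mat_of_rows_list 3 [[1, 0, 0], [0, 0, 0], [0, 0, 1]]"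

lemma less_3_iff: "i < 3 \<longleftrightarrow> i = 0 \<or> i = 1 \<or> i = (2::nat)" by auto

lemma less_6_iff: "i < 6 \<longleftrightarrow> i = 0 \<or> i = 1 \<or> i = 2 \<or> i = 3 \<or> i = 4 \<or> i = (5::nat)" by auto

lemma nilp_carrier [simp]: "nilp \<in> carrier_mat 3 3"
  and diag101_carrier [simp]: "diag101 \<in> carrier_mat 3 3"
  by (auto simp: nilp_def diag101_def mat_of_rows_list_def)

lemmas nilp_diag101_dim [simp] = carrier_matD[OF nilp_carrier] carrier_matD[OF diag101_carrier]

lemma nilp_index: "i < 3 \<Longrightarrow> j < 3 \<Longrightarrow> nilp $$ (i, j) = (if i = 0 \<and> j = 1 then 1 else 0)"
  by (auto simp: nilp_def mat_of_rows_list_def less_3_iff)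

lemma diag101_index:
  "i < 3 \<Longrightarrow> j < 3 \<Longrightarrow> diag101 $$ (i, j) = (if i = j \<and> i \<noteq> 1 then 1 else 0)"
  by (auto simp: diag101_def mat_of_rows_list_def less_3_iff)

text \<open>Unrolls the scalar product into explicit entries. Simplifier calls using it delete
  \<open>index_mult_mat(1)\<close>, which would rewrite the same entry to an abstract scalar
  product.\<close>

lemma mat_mult_index_3:
  assumes "A \<in> carrier_mat 3 3" "B \<in> carrier_mat 3 3" "i < 3" "j < 3"
  shows "(A * B) $$ (i, j) = A $$ (i, 0) * B $$ (0, j) + A $$ (i, 1) * B $$ (1, j) + A $$ (i, 2) * B $$ (2, j)"
  using assms by (simp add: scalar_prod_def eval_nat_numeral)

lemma min_rank_sylvester_nilp: "min_rank_sylvester 3 3 nilp nilp (diag101 :: 'a::field mat) = 2"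
  unfolding min_rank_sylvester_def
proof (rule cInf_eq_minimum)
  \<comment> \<open>The value 2 is attained at X = 0, which leaves -C: its middle diagonal entry is
    0, and its outer two give the minor (-1)(-1) = 1.\<close>
  let ?M = "- diag101 :: 'a mat"
  have dim: "?M \<in> carrier_mat 3 3" by simp
  have idx: "?M $$ (i, j) = (if i = j \<and> i \<noteq> 1 then -1 else 0)" if "i < 3" "j < 3" for i j
    using that by (simp add: diag101_index)
  have "upper_triangular ?M"
    by (auto simp: upper_triangular_def idx simp del: index_uminus_mat(1))
  then have "det ?M = prod_list (diag_mat ?M)" by (rule det_upper_triangular[OF _ dim])
  also have "\<dots> = 0"
    using idx[of 1 1] by (auto simp: diag_mat_def prod_list_zero_iff intro!: image_eqI[of _ _ 1])
  finally have "mat_rank ?M < 3"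
    using vec_space.det_zero_low_rank[OF dim] by (simp add: mat_rank_def)
  moreover have "2 \<le> mat_rank ?M"
    by (rule mat_rank_ge_2[of 0 2 _ 0 2]) (simp_all add: idx del: index_uminus_mat(1))
  ultimately have "mat_rank ?M = 2" by simp
  moreover have "nilp * 0\<^sub>m 3 3 - 0\<^sub>m 3 3 * nilp - diag101 = ?M"
    by (rule eq_matI) (simp_all add: right_mult_zero_mat[OF nilp_carrier]
        left_mult_zero_mat[OF nilp_carrier])
  ultimately show "2 \<in> (\<lambda>X. mat_rank (nilp * X - X * nilp - (diag101 :: 'a mat))) ` carrier_mat 3 3"
    by (intro image_eqI[of _ _ "0\<^sub>m 3 3"]) simp_all
next
  fix r
  assume "r \<in> (\<lambda>X. mat_rank (nilp * X - X * nilp - (diag101 :: 'a mat))) ` carrier_mat 3 3"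
  then obtain X :: "'a mat" where X: "X \<in> carrier_mat 3 3"
    and r: "r = mat_rank (nilp * X - X * nilp - diag101)" by auto
  note idx = X mat_mult_index_3 nilp_index diag101_index carrier_matD[OF X]
  show "2 \<le> r"
  proof (cases "X $$ (1, 0) = 0")
    case True
    \<comment> \<open>The entries at (0,0) and (2,2) are -1 and the one at (2,0) is 0, so the minor
      is 1 whatever stands at (0,2).\<close>
    show ?thesis unfolding r
      by (rule mat_rank_ge_2[of 0 2 _ 0 2]) (use True in \<open>simp_all add: idx del: index_mult_mat(1)\<close>)
  next
    case False
    \<comment> \<open>The entries at (1,1) and (2,2) are -x and -1 and the one at (1,2) is 0, so the
      minor is x.\<close>
    show ?thesis unfolding r
      by (rule mat_rank_ge_2[of 1 2 _ 1 2]) (use False in \<open>simp_all add: idx del: index_mult_mat(1)\<close>)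
  qed
qed

section \<open>The 6x6 block matrices and the second minimum\<close>

definition upper_block :: "'a::field mat" where
  "upper_block = four_block_mat nilp diag101 (0\<^sub>m 3 3) nilp"

definition diag_block :: "'a::field mat" where
  "diag_block = four_block_mat nilp (0\<^sub>m 3 3) (0\<^sub>m 3 3) nilp"

lemma block_carrier [simp]: "upper_block \<in> carrier_mat 6 6" "diag_block \<in> carrier_mat 6 6"
  by (auto simp: upper_block_def diag_block_def)

lemmas block_dim [simp] = carrier_matD[OF block_carrier(1)] carrier_matD[OF block_carrier(2)]

text \<open>With indices from 0, a pair (i, j) is the arrow from the basis vector j to the basis
  vector i; thus (3, 4) is e5 \<rightarrow> e4, the arrow to be erased.\<close>

lemma upper_block_index:
  assumes "i < 6" "j < 6"
  shows "upper_block $$ (i, j) = (if (i, j) \<in> {(0, 1), (0, 3), (2, 5), (3, 4)} then 1 else 0)"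
  using assms unfolding less_6_iff
  by (elim disjE) (simp_all add: upper_block_def nilp_index diag101_index)

lemma diag_block_index:
  assumes "i < 6" "j < 6"
  shows "diag_block $$ (i, j) = (if (i, j) \<in> {(0, 1), (3, 4)} then 1 else 0)"
  using assms unfolding less_6_iff
  by (elim disjE) (simp_all add: diag_block_def nilp_index)

lemma mat_mult_index_6:
  assumes "A \<in> carrier_mat 6 6" "B \<in> carrier_mat 6 6" "i < 6" "j < 6"
  shows "(A * B) $$ (i, j) = (\<Sum>k\<leftarrow>[0, 1, 2, 3, 4, 5]. A $$ (i, k) * B $$ (k, j))"
  using assms by (simp add: scalar_prod_def eval_nat_numeral add.assoc)

text \<open>Maps the chains $e_4 \to e_1$, $e_6 \to e_3$, $e_2 - e_4$, $e_5$ of the truncated block matrix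
  to the chains $e_2 \to e_1$, $e_5 \to e_4$, $e_3$, $e_6$ of the block-diagonal one.\<close>
definition transf :: "'a::field mat" where
  "transf = mat_of_rows_list 6
    [[1, 0, 0, 0, 0, 0],
     [0, 1, 0, 1, 0, 0],
     [0, 1, 0, 0, 0, 0],
     [0, 0, 1, 0, 0, 0],
     [0, 0, 0, 0, 0, 1],
     [0, 0, 0, 0, 1, 0]]"

text \<open>The entry -1 arises because e3 is the image of e2 - e4 under
  \<open>transf\<close>.\<close>

definition transf_inv :: "'a::field mat" where
  "transf_inv = mat_of_rows_list 6
    [[1, 0, 0, 0, 0, 0],
     [0, 0, 1, 0, 0, 0],
     [0, 0, 0, 1, 0, 0],
     [0, 1, -1, 0, 0, 0],
     [0, 0, 0, 0, 0, 1],
     [0, 0, 0, 0, 1, 0]]"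

lemma transf_carrier [simp]: "transf \<in> carrier_mat 6 6" "transf_inv \<in> carrier_mat 6 6"
  by (auto simp: transf_def transf_inv_def mat_of_rows_list_def)

lemmas transf_dim [simp] = carrier_matD[OF transf_carrier(1)] carrier_matD[OF transf_carrier(2)]

lemma transf_index:
  assumes "i < 6" "j < 6"
  shows "transf $$ (i, j) =
    (if (i, j) \<in> {(0, 0), (1, 1), (1, 3), (2, 1), (3, 2), (4, 5), (5, 4)} then 1 else 0)"
  using assms unfolding less_6_iff
  by (elim disjE) (simp_all add: transf_def mat_of_rows_list_def)

lemma transf_inv_index:
  assumes "i < 6" "j < 6"
  shows "transf_inv $$ (i, j) = (if (i, j) = (3, 2) then -1 else
    if (i, j) \<in> {(0, 0), (1, 2), (2, 3), (3, 1), (4, 5), (5, 4)} then 1 else 0)"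
  using assms unfolding less_6_iff
  by (elim disjE) (simp_all add: transf_inv_def mat_of_rows_list_def)

lemma transf_GL: "(transf :: 'a::field mat) \<in> GL 6"
proof -
  have "(transf * transf_inv) $$ (i, j) = (1\<^sub>m 6 :: 'a mat) $$ (i, j)"
    "(transf_inv * transf) $$ (i, j) = (1\<^sub>m 6 :: 'a mat) $$ (i, j)" if "i < 6" "j < 6" for i j
    using that unfolding less_6_iff
    by (elim disjE; simp add: mat_mult_index_6 transf_index transf_inv_index del: index_mult_mat(1))+
  then have "transf * transf_inv = (1\<^sub>m 6 :: 'a mat)" "transf_inv * transf = (1\<^sub>m 6 :: 'a mat)"
    by (intro eq_matI; simp del: index_mult_mat(1))+
  then show ?thesis
    by (auto simp: GL_def invertible_mat_def inverts_mat_def intro!: exI[of _ transf_inv])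
qed

text \<open>Only the arrow e5 \<rightarrow> e4 fails to be intertwined, and \<open>transf\<close>
  sends e4 to e2, so a single entry survives, in row e2 and column e5. The product form, a function
  of i times a function of j, exhibits rank at most 1.\<close>

lemma transf_difference_index:
  assumes "i < 6" "j < 6"
  shows "(transf * upper_block - diag_block * transf) $$ (i, j) =
    (if i = 1 then 1 else 0) * (if j = 4 then 1 else (0::'a::field))"
  using assms unfolding less_6_iff
  by (elim disjE) (simp_all add: mat_mult_index_6 transf_index upper_block_index diag_block_index
      del: index_mult_mat(1))

lemma min_rank_similarity_nilp: "min_rank_similarity 3 3 nilp nilp (diag101 :: 'a::field mat) = 1"
proof -
  let ?d = "\<lambda>P. P * upper_block - diag_block * P :: 'a mat"
  have dc: "?d P \<in> carrier_mat 6 6" if "P \<in> carrier_mat 6 6" for P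
    using that by (intro minus_carrier_mat mult_carrier_mat[of _ 6 6]) auto
  have lower: "1 \<le> mat_rank (?d P)" if P: "P \<in> GL 6" for P
  proof (rule ccontr)
    assume *: "\<not> 1 \<le> mat_rank (?d P)"
    from P have Pc: "P \<in> carrier_mat 6 6" by (simp add: GL_def)
    have d0: "?d P $$ (i, j) = 0" if "i < 6" "j < 6" for i j
      using mat_rank_pos[of i "?d P" j] * that carrier_matD[OF dc[OF Pc]] by metis
    have "P * upper_block = diag_block * P"
    proof (rule eq_matI)
      fix i j assume "i < dim_row (diag_block * P)" "j < dim_col (diag_block * P)"
      then have "i < 6" "j < 6" using Pc by auto
      then show "(P * upper_block) $$ (i, j) = (diag_block * P) $$ (i, j)"
        using d0[of i j] Pc by (simp del: index_mult_mat(1))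
    qed (use Pc in auto)
    moreover have "diag_block * diag_block = (0\<^sub>m 6 6 :: 'a mat)"
      by (rule eq_matI) (auto simp: mat_mult_index_6 diag_block_index simp del: index_mult_mat(1))
    ultimately have "upper_block * upper_block = (0\<^sub>m 6 6 :: 'a mat)"
      using similar_square_zero[OF P block_carrier] by blast
    \<comment> \<open>The chain e5 \<rightarrow> e4 \<rightarrow> e1 makes this entry 1, a
      contradiction in every field.\<close>
    then have "(upper_block * upper_block) $$ (0, 4) = (0::'a)" by simp
    then show False
      by (simp add: mat_mult_index_6 upper_block_index del: index_mult_mat(1))
  qed
  have "mat_rank (?d transf) \<le> 1"
    unfolding mat_rank_def
    by (rule vec_space.rank_le_1_product_entries[OF carrier_matI[OF refl refl]])
      (use transf_difference_index dc[OF transf_carrier(1)] in auto)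
  then have "mat_rank (?d transf) = 1" using lower[OF transf_GL] by simp
  with lower transf_GL have "(INF P\<in>GL 6. mat_rank (?d P)) = 1"
    by (intro cInf_eq_minimum) (force, auto)
  then show ?thesis by (simp add: min_rank_similarity_def upper_block_def diag_block_def)
qed

theorem mainTheorem1:
  fixes A B C :: "'a::field mat"
  assumes "A = mat_of_rows_list 3 [[0, 1, 0], [0, 0, 0], [0, 0, 0]]"
    and "B = mat_of_rows_list 3 [[0, 1, 0], [0, 0, 0], [0, 0, 0]]"
    and "C = mat_of_rows_list 3 [[1, 0, 0], [0, 0, 0], [0, 0, 1]]"
  shows "min_rank_sylvester 3 3 A B C = 2 \<and>
    min_rank_similarity 3 3 A B C = 1 \<and>
    min_rank_sylvester 3 3 A B C \<noteq> min_rank_similarity 3 3 A B C \<and>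
    \<not> (\<forall>m>0. \<forall>n>0. \<forall>A' \<in> carrier_mat m m. \<forall>B' \<in> carrier_mat n n. \<forall>C' \<in> carrier_mat m n.
        min_rank_sylvester m n (A' :: 'a mat) B' C' = min_rank_similarity m n A' B' C')"
proof -
  have ABC: "A = nilp" "B = nilp" "C = diag101"
    using assms by (simp_all add: nilp_def diag101_def)
  have "min_rank_sylvester 3 3 A B C = 2" "min_rank_similarity 3 3 A B C = 1"
    unfolding ABC by (rule min_rank_sylvester_nilp min_rank_similarity_nilp)+
  moreover from this have "min_rank_sylvester 3 3 A B C \<noteq> min_rank_similarity 3 3 A B C" by simp
  moreover have "A \<in> carrier_mat 3 3" "B \<in> carrier_mat 3 3" "C \<in> carrier_mat 3 3"
    unfolding ABC by simp_all
  ultimately show ?thesis by (meson zero_less_numeral)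
qed

end
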